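(* Let $q$ be a complex number with $0<|q|<1$ and let $a,b,c,d$ be nonzero complex numbers such that no denominator occurring below vanishes. Then $$\frac{(b;q)_\infty(c;q)_\infty(qd;q)_\infty(qa^2/bcd;q)_\infty}{(qa/b;q)_\infty(qa/c;q)_\infty(a/d;q)_\infty(bcd/a;q)_\infty} =1+\sum_{n=1}^{\infty}W_n(a,b,c,d)\left(\frac{q^{n}a^2}{bd}\right)^n\frac{(bd/a;q)_{2n}\,(b,\,d,\,qa/bc,\,bc/a,\,qa/cd,\,cd/a;q)_n}{(q,\,qa/c,\,bcd/a;q)_{2n}\,(qa/b,\,a/d;q)_n},$$ where $$W_n(a,b,c,d)=\frac{1-q^{3n}d}{1-d}\left\{1-\frac{(1-q^{2n})(1-q^{-n}b/a)(1-q^{2n}a/c)(1-q^{2n-1}bcd/a)(1-q^{3n-2}b)}{(1-q^na/cd)(1-q^{n-1}b)(1-q^{n-1}bc/a)(1-q^{2n-1}bd/a)(1-q^{3n}d)}\right\}.$$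
   Context: $(x;q)_0=1$, $(x;q)_n=\prod_{j=0}^{n-1}(1-q^jx)$ for $n\ge1$, $(x;q)_\infty=\prod_{j\ge0}(1-q^jx)$, and $(x_1,\dots,x_r;q)_n=(x_1;q)_n\cdots(x_r;q)_n$. Expressions such as $a/bc$ mean $a/(bc)$. *)

theory Defs
  imports "HOL-Analysis.Analysis"
begin

definition qpoch :: "complex \<Rightarrow> complex \<Rightarrow> nat \<Rightarrow> complex" where
  "qpoch x q n = (\<Prod>j<n. 1 - q ^ j * x)"

(* The value is 0 when some factor vanishes; for norm q < 1 the product always converges. *)
definition qpoch_inf :: "complex \<Rightarrow> complex \<Rightarrow> complex" where
  "qpoch_inf x q = (\<Prod>j. 1 - q ^ j * x)"

definition qpochs :: "complex list \<Rightarrow> complex \<Rightarrow> nat \<Rightarrow> complex" where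
  "qpochs xs q n = (\<Prod>x\<leftarrow>xs. qpoch x q n)"

(* W_denom and W are meant for n \<ge> 1, where the natural-number subtractions
   n - 1, 2 * n - 1 and 3 * n - 2 in the exponents do not truncate. *)
definition W_denom :: "complex \<Rightarrow> nat \<Rightarrow> complex \<Rightarrow> complex \<Rightarrow> complex \<Rightarrow> complex \<Rightarrow> complex" where
  "W_denom q n a b c d =
     (1 - q ^ n * a / (c * d)) * (1 - q ^ (n - 1) * b) * (1 - q ^ (n - 1) * b * c / a)
     * (1 - q ^ (2 * n - 1) * b * d / a) * (1 - q ^ (3 * n) * d)"

definition W :: "complex \<Rightarrow> nat \<Rightarrow> complex \<Rightarrow> complex \<Rightarrow> complex \<Rightarrow> complex \<Rightarrow> complex" where
  "W q n a b c d =
     (1 - q ^ (3 * n) * d) / (1 - d) *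
     (1 - (1 - q ^ (2 * n)) * (1 - q powi (- int n) * b / a) * (1 - q ^ (2 * n) * a / c)
          * (1 - q ^ (2 * n - 1) * b * c * d / a) * (1 - q ^ (3 * n - 2) * b)
          / W_denom q n a b c d)"

end

theory Submission
  imports Defs
begin

text \<open>
  Under the shift $(a,b,c,d) \to (q^2a, qb, qc, qd)$ the arguments of all eight infinite products
  are multiplied by $q$, so the left-hand side changes by a rational factor $N/D$. The series $S$
  satisfies the same contiguous relation $D \, S(a,b,c,d) = N \, S(q^2a,qb,qc,qd)$: splitting each
  summand into the two parts of $W_n$ gives a single sequence $u_k$ for which $D u_k - N u'_k$
  telescopes with an explicit hypergeometric certificate of the Wilf-Zeilberger kind. Iterating the
  relation $m$ times and letting $m \to \infty$ yields the identity, since $S \to 1$ along the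
  iteration by a bound of the form $K |q|^m |q^n a^2/(bd)|^{n+1}$ on the summands.
\<close>

section \<open>Finite and infinite q-shifted factorials\<close>

lemma qpoch_0 [simp]: "qpoch x q 0 = 1"
  by (simp add: qpoch_def)

lemma qpoch_Suc: "qpoch x q (Suc n) = qpoch x q n * (1 - q ^ n * x)"
  by (simp add: qpoch_def mult.commute)

lemma qpoch_Suc_shift: "qpoch x q (Suc n) = (1 - x) * qpoch (q * x) q n"
  unfolding qpoch_def prod.lessThan_Suc_shift by (simp add: mult.assoc mult.left_commute)

text \<open>Both sides are \<open>qpoch x q (Suc n)\<close>, with the first or the last factor split
  off. This trades factors of \<open>D\<close> and \<open>N\<close> for last factors when an
  argument is multiplied by \<open>q\<close>.\<close>

lemma qpoch_contiguous: "(1 - x) * qpoch (q * x) q n = qpoch x q n * (1 - q ^ n * x)"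
  using qpoch_Suc qpoch_Suc_shift by metis

lemma qpoch_add: "qpoch x q (m + n) = qpoch x q m * qpoch (q ^ m * x) q n"
  by (induction n) (simp_all add: qpoch_Suc power_add mult_ac)

lemma qpoch_nonzero: "(\<And>j. 1 - q ^ j * x \<noteq> 0) \<Longrightarrow> qpoch x q n \<noteq> 0"
  by (simp add: qpoch_def)

lemma qpoch_nonzero_factor: "qpoch x q n \<noteq> 0 \<Longrightarrow> j < n \<Longrightarrow> 1 - q ^ j * x \<noteq> 0"
  by (auto simp: qpoch_def)

lemma qpoch_shift_nonzero:
  assumes "\<And>j. 1 - q ^ j * x \<noteq> 0"
  shows "qpoch (q * x) q n \<noteq> 0"
  using assms[of "Suc j" for j] by (intro qpoch_nonzero) (simp add: mult_ac)

lemma qpoch_convergent_prod: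
  fixes q x :: complex
  assumes "norm q < 1"
  shows "convergent_prod (\<lambda>j. 1 - q ^ j * x)"
proof -
  have "summable (\<lambda>j. norm ((1 - q ^ j * x) - 1))"
    using assms by (simp add: norm_mult norm_power summable_mult2 summable_geometric)
  then show ?thesis
    by (intro abs_convergent_prod_imp_convergent_prod summable_imp_abs_convergent_prod)
qed

text \<open>Convergence of the product allows finitely many vanishing factors; the partial products
  are then eventually 0, as is the limit. Numerator products may have such factors.\<close>

lemma qpoch_tendsto:
  assumes "norm q < 1"
  shows "(\<lambda>n. qpoch x q n) \<longlonglongrightarrow> qpoch_inf x q"
  unfolding qpoch_def qpoch_inf_def
  using convergent_prod_has_prod[OF qpoch_convergent_prod[OF assms]] by (rule has_prod_imp_tendsto')

section \<open>Bounds uniform in length and argument\<close>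

text \<open>The factors are bounded by exponentials whose exponents form a geometric series, so the
  bound depends neither on \<open>k i\<close> nor on \<open>y i\<close>. The free index type serves
  sequences and pairs of naturals alike.\<close>

lemma qpoch_bounded:
  fixes y :: "'i \<Rightarrow> complex"
  assumes "norm q < 1" "\<And>i. norm (y i) \<le> r"
  shows "bounded (range (\<lambda>i. qpoch (y i) q (k i)))"
proof -
  have "norm (qpoch (y i) q (k i)) \<le> exp (r / (1 - norm q))" for i
  proof -
    have r: "0 \<le> r" using assms(2)[of i] norm_ge_zero order_trans by blast
    have "norm (qpoch (y i) q (k i)) \<le> (\<Prod>j<k i. exp (norm q ^ j * r))"
      unfolding qpoch_def prod_norm [symmetric]
    proof (intro prod_mono conjI norm_ge_zero)
      fix j
      have "norm (1 - q ^ j * y i) \<le> 1 + norm q ^ j * norm (y i)"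
        by (metis norm_triangle_ineq4 norm_one norm_mult norm_power)
      also have "\<dots> \<le> 1 + norm q ^ j * r"
        using assms(2) by (intro add_left_mono mult_left_mono) auto
      also have "\<dots> \<le> exp (norm q ^ j * r)" by (rule exp_ge_add_one_self)
      finally show "norm (1 - q ^ j * y i) \<le> exp (norm q ^ j * r)" .
    qed
    also have "\<dots> = exp ((\<Sum>j<k i. norm q ^ j) * r)"
      by (simp add: exp_sum sum_distrib_right)
    also have "(\<Sum>j<k i. norm q ^ j) \<le> (\<Sum>j. norm q ^ j)"
      using assms by (intro sum_le_suminf) (auto intro: summable_geometric)
    then have "exp ((\<Sum>j<k i. norm q ^ j) * r) \<le> exp (r / (1 - norm q))"
      using assms r by (auto simp: suminf_geometric dest: mult_right_mono[of _ _ r])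
    finally show ?thesis .
  qed
  then show ?thesis unfolding bounded_iff by blast
qed

text \<open>By \<open>qpoch_add\<close> the inverse is
  \<open>qpoch x q m / qpoch x q (m + k)\<close>. The numerators are bounded, and the denominators
  stay away from 0 because they never vanish and tend to a nonzero infinite product.\<close>

lemma qpoch_inverse_bounded:
  fixes m k :: "'i \<Rightarrow> nat"
  assumes "norm q < 1" "\<And>j. 1 - q ^ j * x \<noteq> 0"
  shows "bounded (range (\<lambda>i. inverse (qpoch (q ^ m i * x) q (k i))))"
proof -
  have "qpoch_inf x q \<noteq> 0"
    unfolding qpoch_inf_def using assms by (intro prodinf_nonzero qpoch_convergent_prod)
  then have "Bseq (\<lambda>n. inverse (qpoch x q n))"
    using convergent_imp_Bseq[OF convergentI[OF tendsto_inverse[OF qpoch_tendsto[OF assms(1)]]]] by blast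
  then obtain B where B: "\<And>n. norm (inverse (qpoch x q n)) \<le> B"
    by (meson BseqE)
  have "bounded (range (\<lambda>n. qpoch x q n))"
    using assms by (intro qpoch_bounded) auto
  then obtain C where C: "\<And>n. norm (qpoch x q n) \<le> C"
    by (auto simp: bounded_iff)
  have "norm (inverse (qpoch (q ^ m i * x) q (k i))) \<le> C * B" for i
  proof -
    have "inverse (qpoch (q ^ m i * x) q (k i)) = qpoch x q (m i) * inverse (qpoch x q (m i + k i))"
      using assms(2) qpoch_nonzero[of q x "m i"]
      by (simp add: qpoch_add)
    also have "norm \<dots> \<le> C * B"
      unfolding norm_mult using B C order_trans[OF norm_ge_zero C] by (intro mult_mono) auto
    finally show ?thesis .
  qed
  then show ?thesis unfolding bounded_iff by blast
qed

text \<open>The base tends to 0, so a geometric series of ratio 1/2 eventually dominates. This is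
  the majorant for both the certificates and the series.\<close>

lemma superexponential_summable:
  fixes q w :: complex
  assumes "norm q < 1"
  shows "summable (\<lambda>n. norm (q ^ n * w) ^ Suc n)"
proof -
  have "(\<lambda>n. norm (q ^ n * w)) \<longlonglongrightarrow> 0"
    using assms by (intro tendsto_norm_zero tendsto_mult_left_zero LIMSEQ_power_zero)
  then have "\<forall>\<^sub>F n in sequentially. norm (q ^ n * w) < 1 / 2"
    by (rule order_tendstoD) simp
  then have "\<forall>\<^sub>F n in sequentially. norm (norm (q ^ n * w) ^ Suc n) \<le> (1 / 2) ^ Suc n"
    by eventually_elim (auto simp del: power_Suc intro!: power_mono)
  then show ?thesis
    by (rule summable_comparison_test_ev) (simp add: summable_mult summable_geometric)
qed

lemma bounded_range_mult:
  fixes f g :: "'i \<Rightarrow> complex"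
  assumes "bounded (range f)" "bounded (range g)"
  shows "bounded (range (\<lambda>i. f i * g i))"
proof -
  obtain B where B: "\<And>i. norm (f i) \<le> B" using assms(1) by (auto simp: bounded_iff)
  obtain C where C: "\<And>i. norm (g i) \<le> C" using assms(2) by (auto simp: bounded_iff)
  have "norm (f i * g i) \<le> B * C" for i
    unfolding norm_mult using B C order_trans[OF norm_ge_zero B] by (intro mult_mono) auto
  then show ?thesis unfolding bounded_iff by blast
qed

lemma bounded_range_inverse_mult:
  fixes f g :: "'i \<Rightarrow> complex"
  assumes "bounded (range (\<lambda>i. inverse (f i)))" "bounded (range (\<lambda>i. inverse (g i)))"
  shows "bounded (range (\<lambda>i. inverse (f i * g i)))"
  using bounded_range_mult[OF assms] by simp

lemma bounded_range_divide:
  fixes f g :: "'i \<Rightarrow> complex"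
  assumes "bounded (range f)" "bounded (range (\<lambda>i. inverse (g i)))"
  shows "bounded (range (\<lambda>i. f i / g i))"
  using bounded_range_mult[OF assms] by (simp add: divide_inverse)

section \<open>Polynomial identities behind the telescoping\<close>

text \<open>What is left of \<open>even_step\<close> once the common hypergeometric factor is
  divided out. \<open>Q\<close> stands for \<open>q ^ Suc n\<close> but is a free variable
  here.\<close>

lemma even_polynomial_identity:
  fixes a b c d q Q :: complex
  assumes "a \<noteq> 0" "b \<noteq> 0" "c \<noteq> 0" "d \<noteq> 0"
  shows "(1 - Q ^ 3 * d) * (1 - Q\<^sup>2 * (q * a / c)) * (1 - Q\<^sup>2 * (b * c * d / a))
           * (1 - Q * (q * a / b)) * (1 - Q * (a / d))
         - Q\<^sup>2 * (1 - Q ^ 3 * (q * d)) * (1 - Q * b) * (1 - Q * d) * (1 - c)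
           * (1 - q * a\<^sup>2 / (b * c * d))
         = - (Q * (a / d)) * (1 - Q\<^sup>2 * (q * a)) * (1 - Q * d) * (1 - Q\<^sup>2 * (b * d / a))
           * (1 - Q * (q * a / (b * c))) * (1 - Q * (c * d / a))
         + (1 - Q\<^sup>2 * a) * (1 - Q\<^sup>2) * (1 - Q\<^sup>2 * (q * a / c))
           * (1 - Q\<^sup>2 * (b * c * d / a)) * (1 - Q * (q * a / b))"
  using assms by (simp add: divide_simps) algebra

text \<open>The counterpart for \<open>odd_step\<close>. Now \<open>R\<close> stands for
  \<open>q ^ n\<close>, so that \<open>q ^ (2 * n + 1)\<close> becomes \<open>q\<close> times the
  square of \<open>R\<close>.\<close>

lemma odd_polynomial_identity:
  fixes a b c d q R :: complex
  assumes "a \<noteq> 0" "b \<noteq> 0" "c \<noteq> 0" "d \<noteq> 0" "q \<noteq> 0" "R \<noteq> 0"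
  shows "(q * R)\<^sup>2 * (1 - b / (q * (q * R) * a)) * (1 - q * R ^ 3 * (q * b)) * (1 - R * b)
           * (1 - q * R * d) * (1 - c) * (1 - q * a\<^sup>2 / (b * c * d))
         - (1 - b / (q * R * a)) * (1 - q * R ^ 3 * b) * (1 - q * R\<^sup>2 * (q * a / c))
           * (1 - q * R\<^sup>2 * (b * c * d / a)) * (1 - q * R * (q * a / b)) * (1 - q * R * (a / d))
         = b / (q * R * a) * (1 - q * R\<^sup>2 * a) * (1 - q * R\<^sup>2)
           * (1 - q * R\<^sup>2 * (q * a / c)) * (1 - q * R\<^sup>2 * (b * c * d / a))
           * (1 - q * R * (q * a / b)) * (1 - q * R * (a / d))
         - (1 - (q * R)\<^sup>2 * a) * (1 - R * b) * (1 - q * R\<^sup>2 * (b * d / a))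
           * (1 - R * (b * c / a)) * (1 - R * (q * a / (c * d))) * (1 - q * R * (q * a / b))"
  using assms by (simp add: divide_simps) algebra

section \<open>The split summands and their telescoping certificates\<close>

text \<open>
  The two parts of $W_{n+1}$ times the rest of the summand of index $n+1$, with the denominator of
  $W_{n+1}$ cancelled, so that only the denominators of the series itself remain.
\<close>

definition even_term :: "complex \<Rightarrow> complex \<Rightarrow> complex \<Rightarrow> complex \<Rightarrow> complex \<Rightarrow> nat \<Rightarrow> complex" where
  "even_term q a b c d n =
     (q ^ Suc n * a\<^sup>2 / (b * d)) ^ Suc n * (1 - q ^ (3 * n + 3) * d)
     * (qpoch (b * d / a) q (2 * n + 2) * qpoch b q (Suc n) * qpoch (q * d) q n
        * (qpoch (q * a / (b * c)) q (Suc n) * qpoch (b * c / a) q (Suc n)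
        * qpoch (q * a / (c * d)) q (Suc n) * qpoch (c * d / a) q (Suc n)))
     / (qpoch q q (2 * n + 2) * qpoch (q * a / c) q (2 * n + 2) * qpoch (b * c * d / a) q (2 * n + 2)
        * qpoch (q * a / b) q (Suc n) * qpoch (a / d) q (Suc n))"

definition odd_term :: "complex \<Rightarrow> complex \<Rightarrow> complex \<Rightarrow> complex \<Rightarrow> complex \<Rightarrow> nat \<Rightarrow> complex" where
  "odd_term q a b c d n =
     (q ^ Suc n * a\<^sup>2 / (b * d)) ^ Suc n * (1 - b / (q ^ Suc n * a)) * (1 - q ^ (3 * n + 1) * b)
     * (qpoch (b * d / a) q (2 * n + 1) * qpoch b q n * qpoch (q * d) q n
        * (qpoch (q * a / (b * c)) q (Suc n) * qpoch (b * c / a) q n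
        * qpoch (q * a / (c * d)) q n * qpoch (c * d / a) q (Suc n)))
     / (qpoch q q (2 * n + 1) * qpoch (q * a / c) q (2 * n + 1) * qpoch (b * c * d / a) q (2 * n + 1)
        * qpoch (q * a / b) q (Suc n) * qpoch (a / d) q (Suc n))"

text \<open>
  With $u_{2k} = $ even, $u_{2k-1} = -$ odd term of paper index $k$ and $u_0 = 1$, the partial sums
  $g_k = \sum_{j<k} (D u_j - N u'_j)$ have closed forms: \<open>odd_cert n\<close> is $g_{2n+1}$ and
  \<open>even_cert n\<close> is $g_{2n+2}$.
\<close>

definition odd_cert :: "complex \<Rightarrow> complex \<Rightarrow> complex \<Rightarrow> complex \<Rightarrow> complex \<Rightarrow> nat \<Rightarrow> complex" where
  "odd_cert q a b c d n =
     - (a / d) * (q ^ Suc n * a\<^sup>2 / (b * d)) ^ n * (1 - q ^ (2 * n + 1) * a)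
     * (qpoch (b * d / a) q (2 * n + 1) * qpoch b q n * qpoch (q * d) q n
        * (qpoch (q * a / (b * c)) q (Suc n) * qpoch (b * c / a) q n
        * qpoch (q * a / (c * d)) q n * qpoch (c * d / a) q (Suc n)))
     / (qpoch q q (2 * n) * qpoch (q * (q * a / c)) q (2 * n) * qpoch (q * (b * c * d / a)) q (2 * n)
        * qpoch (q * (q * a / b)) q n * qpoch (q * (a / d)) q n)"

definition even_cert :: "complex \<Rightarrow> complex \<Rightarrow> complex \<Rightarrow> complex \<Rightarrow> complex \<Rightarrow> nat \<Rightarrow> complex" where
  "even_cert q a b c d n =
     - ((q ^ Suc n * a\<^sup>2 / (b * d)) ^ Suc n) * (1 - q ^ (2 * n + 2) * a)
     * (qpoch (b * d / a) q (2 * n + 2) * qpoch b q (Suc n) * qpoch (q * d) q n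
        * (qpoch (q * a / (b * c)) q (Suc n) * qpoch (b * c / a) q (Suc n)
        * qpoch (q * a / (c * d)) q (Suc n) * qpoch (c * d / a) q (Suc n)))
     / (qpoch q q (2 * n + 1) * qpoch (q * (q * a / c)) q (2 * n + 1) * qpoch (q * (b * c * d / a)) q (2 * n + 1)
        * qpoch (q * (q * a / b)) q n * qpoch (q * (a / d)) q (Suc n))"

text \<open>Agrees with the series term of index \<open>n + 1\<close> by \<open>summand_eq\<close>,
  but remains usable for scaled parameters at which a denominator of \<open>W\<close> might
  vanish.\<close>

definition summand :: "complex \<Rightarrow> complex \<Rightarrow> complex \<Rightarrow> complex \<Rightarrow> complex \<Rightarrow> nat \<Rightarrow> complex" where
  "summand q a b c d n = even_term q a b c d n - odd_term q a b c d n"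

section \<open>Admissible parameters and their scaling\<close>

text \<open>Each nonvanishing condition covers all \<open>j\<close>, so multiplying its argument by
  \<open>q ^ m\<close> only moves \<open>j\<close> to \<open>j + m\<close>. The locale is therefore
  stable under the shift, and the contiguous relation can be iterated.\<close>

locale admissible =
  fixes q a b c d :: complex
  assumes q_pos: "0 < norm q" and q_less_1: "norm q < 1"
    and nonzero: "a \<noteq> 0" "b \<noteq> 0" "c \<noteq> 0" "d \<noteq> 0"
    and c_nz: "\<And>j. 1 - q ^ j * (q * a / c) \<noteq> 0"
    and bcd_nz: "\<And>j. 1 - q ^ j * (b * c * d / a) \<noteq> 0"
    and b_nz: "\<And>j. 1 - q ^ j * (q * a / b) \<noteq> 0"
    and d_nz: "\<And>j. 1 - q ^ j * (a / d) \<noteq> 0"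
begin

text \<open>The first factors of the four denominator products; \<open>N\<close> collects those of
  the four numerator products.\<close>

definition "D = (1 - q * a / b) * (1 - q * a / c) * (1 - a / d) * (1 - b * c * d / a)"
definition "N = (1 - b) * (1 - c) * (1 - q * d) * (1 - q * a\<^sup>2 / (b * c * d))"

lemma q_nz: "q \<noteq> 0" using q_pos by auto

lemma q_power_nz: "1 - q ^ j * q \<noteq> 0"
proof
  assume "1 - q ^ j * q = 0"
  then have "norm (q ^ Suc j) = 1" by (simp add: mult.commute)
  moreover have "norm (q ^ Suc j) \<le> norm q ^ 1"
    unfolding norm_power using q_pos q_less_1 by (intro power_decreasing) auto
  ultimately show False using q_less_1 by simp
qed

text \<open>Give \<open>a\<close> weight 2 and \<open>b\<close>, \<open>c\<close>, \<open>d\<close>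
  weight 1. The four denominator arguments then have weight 1, quotients such as
  \<open>b * d / a\<close> weight 0, and the base of the power weight 2.\<close>

lemma scaled_args:
  assumes "r \<noteq> 0"
  shows "q * (r\<^sup>2 * a) / (r * c) = r * (q * a / c)"
    "(r * b) * (r * c) * (r * d) / (r\<^sup>2 * a) = r * (b * c * d / a)"
    "q * (r\<^sup>2 * a) / (r * b) = r * (q * a / b)"
    "(r\<^sup>2 * a) / (r * d) = r * (a / d)"
    "(r * b) * (r * d) / (r\<^sup>2 * a) = b * d / a"
    "(r * b) * (r * c) / (r\<^sup>2 * a) = b * c / a"
    "(r * c) * (r * d) / (r\<^sup>2 * a) = c * d / a"
    "q * (r\<^sup>2 * a) / ((r * b) * (r * c)) = q * a / (b * c)"
    "q * (r\<^sup>2 * a) / ((r * c) * (r * d)) = q * a / (c * d)"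
    "x * (r\<^sup>2 * a)\<^sup>2 / ((r * b) * (r * d)) = r\<^sup>2 * (x * a\<^sup>2 / (b * d))"
  using assms nonzero by (simp_all add: power2_eq_square field_simps)

lemmas shifted_args = scaled_args[OF q_nz]

lemma scaled_admissible: "admissible q ((q ^ m)\<^sup>2 * a) (q ^ m * b) (q ^ m * c) (q ^ m * d)"
proof
  have r: "q ^ m \<noteq> 0" using q_nz by simp
  show "1 - q ^ j * (q * ((q ^ m)\<^sup>2 * a) / (q ^ m * c)) \<noteq> 0"
    "1 - q ^ j * (q ^ m * b * (q ^ m * c) * (q ^ m * d) / ((q ^ m)\<^sup>2 * a)) \<noteq> 0"
    "1 - q ^ j * (q * ((q ^ m)\<^sup>2 * a) / (q ^ m * b)) \<noteq> 0"
    "1 - q ^ j * ((q ^ m)\<^sup>2 * a / (q ^ m * d)) \<noteq> 0" for j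
    unfolding scaled_args[OF r] mult.assoc[symmetric, of "q ^ j" "q ^ m"] power_add[symmetric]
    by (rule c_nz bcd_nz b_nz d_nz)+
qed (use q_pos q_less_1 q_nz nonzero in auto)

lemmas shifted_admissible = scaled_admissible[of 1, unfolded power_one_right]

lemmas all_nz = q_power_nz c_nz bcd_nz b_nz d_nz

section \<open>Telescoping of the even and odd terms\<close>

text \<open>The difference g_{2n+3} - g_{2n+2}. All four quantities are multiples of one factor
  \<open>C\<close>, and their cofactors satisfy \<open>even_polynomial_identity\<close>.\<close>

lemma even_step:
  "D * even_term q a b c d n - N * even_term q (q\<^sup>2 * a) (q * b) (q * c) (q * d) n
   = odd_cert q a b c d (Suc n) - even_cert q a b c d n"
proof -
  define Q where "Q = q ^ Suc n"
  define w where "w = Q * a\<^sup>2 / (b * d)"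
  \<comment> \<open>\<open>Suc M\<close> is the length \<open>2 * n + 2\<close> of the long
    products.\<close>
  define M where "M = Suc (2 * n)"
  have Q: "q ^ (3 * n + 3) = Q ^ 3" "q ^ Suc M = Q\<^sup>2" "q ^ Suc n = Q" "q * q ^ n = Q" "Q \<noteq> 0"
  proof -
    have "3 * n + 3 = Suc n * 3" "Suc M = Suc n * 2"
      by (simp_all add: M_def)
    then show "q ^ (3 * n + 3) = Q ^ 3" "q ^ Suc M = Q\<^sup>2"
      by (simp_all only: Q_def power_mult)
  qed (use q_nz in \<open>simp_all add: Q_def\<close>)
  define K where "K = qpoch (q * a / (b * c)) q (Suc n) * qpoch (b * c / a) q (Suc n)
        * (qpoch (q * a / (c * d)) q (Suc n) * qpoch (c * d / a) q (Suc n))"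
  define U where "U = qpoch (b * d / a) q (Suc M)"
  define F where "F = qpoch (q * b) q n"
  define G where "G = qpoch (q * d) q n"
  define E where "E = qpoch q q (Suc M)"
  define x y v u where "x = q * a / c" and "y = b * c * d / a" and "v = q * a / b" and "u = a / d"
  \<comment> \<open>These are denominators of the shifted term; they serve as common denominators
    for all four quantities.\<close>
  define Lx where "Lx = qpoch (q * x) q (Suc M)"
  define Ly where "Ly = qpoch (q * y) q (Suc M)"
  define Lv where "Lv = qpoch (q * v) q (Suc n)"
  define Lu where "Lu = qpoch (q * u) q (Suc n)"
  define C where "C = w ^ Suc n * U * F * G * K * (1 - b) / (E * Lx * Ly * Lv * Lu)"
  have L_nz: "E \<noteq> 0" "Lx \<noteq> 0" "Ly \<noteq> 0" "Lv \<noteq> 0" "Lu \<noteq> 0"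
    unfolding E_def Lx_def Ly_def Lv_def Lu_def x_def y_def v_def u_def
    by (intro qpoch_nonzero qpoch_shift_nonzero all_nz)+
  have den_nz: "qpoch x q (Suc M) \<noteq> 0" "qpoch y q (Suc M) \<noteq> 0"
    "qpoch v q (Suc n) \<noteq> 0" "qpoch u q (Suc n) \<noteq> 0"
    unfolding x_def y_def v_def u_def by (intro qpoch_nonzero all_nz)+
  have factor_nz: "1 - Q\<^sup>2 \<noteq> 0" "1 - Q\<^sup>2 * x \<noteq> 0" "1 - Q\<^sup>2 * y \<noteq> 0" "1 - Q * v \<noteq> 0" "1 - Q * u \<noteq> 0"
    using q_power_nz[of M] c_nz[of "Suc M"] bcd_nz[of "Suc M"] b_nz[of "Suc n"] d_nz[of "Suc n"]
    unfolding x_def y_def v_def u_def Q(2,3) by (simp_all add: Q(2)[symmetric] mult.commute)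
  \<comment> \<open>Each factor of \<open>D\<close> cancels an old denominator and leaves a new last
    factor over the shifted one, which brings \<open>even_term\<close> to the denominators of
    \<open>C\<close>.\<close>
  have x_rel: "1 - x = qpoch x q (Suc M) * (1 - Q\<^sup>2 * x) / Lx"
    and y_rel: "1 - y = qpoch y q (Suc M) * (1 - Q\<^sup>2 * y) / Ly"
    and v_rel: "1 - v = qpoch v q (Suc n) * (1 - Q * v) / Lv"
    and u_rel: "1 - u = qpoch u q (Suc n) * (1 - Q * u) / Lu"
    using L_nz qpoch_contiguous[of x q "Suc M"] qpoch_contiguous[of y q "Suc M"]
      qpoch_contiguous[of v q "Suc n"] qpoch_contiguous[of u q "Suc n"]
    unfolding Q(2,3) Lx_def Ly_def Lv_def Lu_def by (simp_all add: field_simps)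
  have d_rel: "(1 - q * d) * qpoch (q * (q * d)) q n = G * (1 - Q * d)"
    using qpoch_contiguous[of "q * d" q n] unfolding G_def Q_def by (simp add: mult_ac)
  have b_Suc: "qpoch b q (Suc n) = (1 - b) * F" "qpoch (q * b) q (Suc n) = F * (1 - Q * b)"
    "qpoch (q * d) q (Suc n) = G * (1 - Q * d)"
    unfolding F_def G_def using qpoch_Suc_shift[of b q n] qpoch_Suc[of "q * b" q n] qpoch_Suc[of "q * d" q n]
    by (simp_all add: Q_def mult_ac)
  have M: "2 * n + 2 = Suc M" "2 * n + 1 = M" "2 * Suc n + 1 = Suc (Suc M)" "2 * Suc n = Suc M"
    by (simp_all add: M_def)
  have 1: "D * even_term q a b c d n
      = C * ((1 - Q ^ 3 * d) * (1 - Q\<^sup>2 * x) * (1 - Q\<^sup>2 * y) * (1 - Q * v) * (1 - Q * u))"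
    unfolding D_def even_term_def M b_Suc unfolding Q(1,3)
    unfolding x_def[symmetric] y_def[symmetric] v_def[symmetric] u_def[symmetric]
      w_def[symmetric] E_def[symmetric] U_def[symmetric] G_def[symmetric]
    unfolding x_rel y_rel v_rel u_rel C_def K_def
    using den_nz L_nz by (simp add: divide_simps)
  have 2: "N * even_term q (q\<^sup>2 * a) (q * b) (q * c) (q * d) n
      = C * (Q\<^sup>2 * (1 - Q ^ 3 * (q * d)) * (1 - Q * b) * (1 - Q * d) * (1 - c)
           * (1 - q * a\<^sup>2 / (b * c * d)))"
  proof -
    have "(q\<^sup>2 * w) ^ Suc n = Q\<^sup>2 * w ^ Suc n"
      unfolding power_mult_distrib[of "q\<^sup>2"] Q_def by (simp only: power_mult [symmetric] mult.commute)
    then have "N * even_term q (q\<^sup>2 * a) (q * b) (q * c) (q * d) n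
      = Q\<^sup>2 * (w ^ Suc n * U * K / (E * Lx * Ly * Lv * Lu))
        * (1 - Q ^ 3 * (q * d)) * (F * (1 - Q * b)) * (1 - b)
        * ((1 - q * d) * qpoch (q * (q * d)) q n) * ((1 - c) * (1 - q * a\<^sup>2 / (b * c * d)))"
      unfolding N_def even_term_def M shifted_args b_Suc unfolding Q(1,3)
      unfolding x_def[symmetric] y_def[symmetric] v_def[symmetric] u_def[symmetric]
        w_def[symmetric] E_def[symmetric] U_def[symmetric]
        Lx_def[symmetric] Ly_def[symmetric] Lv_def[symmetric] Lu_def[symmetric] C_def K_def
      by (simp only: times_divide_eq_right times_divide_eq_left mult_ac)
    then show ?thesis
      unfolding d_rel C_def by (simp only: times_divide_eq_right times_divide_eq_left mult_ac)
  qed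
  have 3: "odd_cert q a b c d (Suc n)
      = C * (- (Q * (a / d)) * (1 - Q\<^sup>2 * (q * a)) * (1 - Q * d) * (1 - Q\<^sup>2 * (b * d / a))
           * (1 - Q * (q * a / (b * c))) * (1 - Q * (c * d / a)))"
  proof -
    \<comment> \<open>At index \<open>Suc n\<close> the base gains one \<open>q\<close> while the
      exponent is \<open>Suc n\<close>, so an extra factor \<open>Q\<close> appears.\<close>
    have "q ^ Suc (Suc n) * a\<^sup>2 / (b * d) = q * w" by (simp add: w_def Q_def)
    then have pow: "(q ^ Suc (Suc n) * a\<^sup>2 / (b * d)) ^ Suc n = Q * w ^ Suc n"
      by (simp add: power_mult_distrib Q_def)
    have Suc3: "q ^ Suc (Suc M) * a = Q\<^sup>2 * (q * a)"
      using Q(2) by (simp add: mult_ac)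
    show ?thesis
      unfolding odd_cert_def M(3) unfolding M(4) pow b_Suc Suc3
      unfolding qpoch_Suc[of _ q "Suc n"] qpoch_Suc[of _ q "Suc M"] Q(2,3)
      unfolding x_def[symmetric] y_def[symmetric] v_def[symmetric] u_def[symmetric]
      unfolding E_def[symmetric] U_def[symmetric]
        Lx_def[symmetric] Ly_def[symmetric] Lv_def[symmetric] Lu_def[symmetric] C_def K_def
      using L_nz by (simp add: divide_simps)
  qed
  have 4: "even_cert q a b c d n
      = - (C * ((1 - Q\<^sup>2 * a) * (1 - Q\<^sup>2) * (1 - Q\<^sup>2 * x) * (1 - Q\<^sup>2 * y) * (1 - Q * v)))"
  proof -
    \<comment> \<open>All certificate denominators except the one in \<open>a / d\<close> are one
      factor shorter than those of \<open>C\<close>.\<close>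
    have "E = qpoch q q M * (1 - Q\<^sup>2)" "Lx = qpoch (q * x) q M * (1 - Q\<^sup>2 * x)"
      "Ly = qpoch (q * y) q M * (1 - Q\<^sup>2 * y)" "Lv = qpoch (q * v) q n * (1 - Q * v)"
      using Q(2) unfolding E_def Lx_def Ly_def Lv_def Q_def qpoch_Suc
      by (simp_all add: mult_ac)
    then show ?thesis
      unfolding even_cert_def M b_Suc Q(2,3)
      unfolding x_def[symmetric] y_def[symmetric] v_def[symmetric] u_def[symmetric]
      unfolding w_def[symmetric] U_def[symmetric] G_def[symmetric] Lu_def[symmetric] C_def K_def
      using L_nz factor_nz by (simp add: divide_simps)
  qed
  show ?thesis
    unfolding 1 2 3 4
    using even_polynomial_identity[OF nonzero, of Q q]
    unfolding x_def y_def v_def u_def by (simp only: right_diff_distrib [symmetric] diff_minus_eq_add distrib_left [symmetric])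
qed

text \<open>The difference g_{2n+2} - g_{2n+1}. The odd term enters the sequence with a minus sign,
  hence the reversed order on the left.\<close>

lemma odd_step:
  "N * odd_term q (q\<^sup>2 * a) (q * b) (q * c) (q * d) n - D * odd_term q a b c d n
   = even_cert q a b c d n - odd_cert q a b c d n"
proof -
  define R where "R = q ^ n"
  define w where "w = q * R * a\<^sup>2 / (b * d)"
  define M where "M = Suc (2 * n)"
  have R: "q ^ (3 * n + 1) = q * R ^ 3" "q ^ M = q * R\<^sup>2" "q ^ n = R" "q ^ Suc n = q * R" "R \<noteq> 0"
  proof -
    have "3 * n + 1 = Suc (n * 3)" "M = Suc (n * 2)"
      by (simp_all add: M_def)
    then show "q ^ (3 * n + 1) = q * R ^ 3" "q ^ M = q * R\<^sup>2"
      by (simp_all only: R_def power_mult power_Suc)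
  qed (use q_nz in \<open>simp_all add: R_def\<close>)
  define K where "K = qpoch (q * a / (b * c)) q (Suc n) * qpoch (b * c / a) q n
        * (qpoch (q * a / (c * d)) q n * qpoch (c * d / a) q (Suc n))"
  define U where "U = qpoch (b * d / a) q M"
  define F where "F = qpoch b q n"
  define G where "G = qpoch (q * d) q n"
  define E where "E = qpoch q q M"
  define x y v u where "x = q * a / c" and "y = b * c * d / a" and "v = q * a / b" and "u = a / d"
  define Lx where "Lx = qpoch (q * x) q M"
  define Ly where "Ly = qpoch (q * y) q M"
  define Lv where "Lv = qpoch (q * v) q (Suc n)"
  define Lu where "Lu = qpoch (q * u) q (Suc n)"
  \<comment> \<open>Unlike in \<open>even_step\<close>, \<open>F\<close> keeps the unshifted
    argument \<open>b\<close>, so no factor \<open>1 - b\<close> is split off; \<open>b_rel\<close>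
    converts the shifted term instead.\<close>
  define C where "C = w ^ Suc n * U * F * G * K / (E * Lx * Ly * Lv * Lu)"
  have L_nz: "E \<noteq> 0" "Lx \<noteq> 0" "Ly \<noteq> 0" "Lv \<noteq> 0" "Lu \<noteq> 0"
    unfolding E_def Lx_def Ly_def Lv_def Lu_def x_def y_def v_def u_def
    by (intro qpoch_nonzero qpoch_shift_nonzero all_nz)+
  have den_nz: "qpoch x q M \<noteq> 0" "qpoch y q M \<noteq> 0" "qpoch v q (Suc n) \<noteq> 0" "qpoch u q (Suc n) \<noteq> 0"
    unfolding x_def y_def v_def u_def by (intro qpoch_nonzero all_nz)+
  have factor_nz: "1 - q * R\<^sup>2 \<noteq> 0" "1 - q * R\<^sup>2 * x \<noteq> 0" "1 - q * R\<^sup>2 * y \<noteq> 0"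
    "1 - q * R * v \<noteq> 0" "1 - q * R * u \<noteq> 0"
    using q_power_nz[of "2 * n"] c_nz[of M] bcd_nz[of M] b_nz[of "Suc n"] d_nz[of "Suc n"]
    unfolding x_def y_def v_def u_def R(2,4) by (simp_all add: R(2)[unfolded M_def, symmetric] mult.commute)
  have x_rel: "1 - x = qpoch x q M * (1 - q * R\<^sup>2 * x) / Lx"
    and y_rel: "1 - y = qpoch y q M * (1 - q * R\<^sup>2 * y) / Ly"
    and v_rel: "1 - v = qpoch v q (Suc n) * (1 - q * R * v) / Lv"
    and u_rel: "1 - u = qpoch u q (Suc n) * (1 - q * R * u) / Lu"
    using L_nz qpoch_contiguous[of x q M] qpoch_contiguous[of y q M]
      qpoch_contiguous[of v q "Suc n"] qpoch_contiguous[of u q "Suc n"]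
    unfolding R(2,4) Lx_def Ly_def Lv_def Lu_def by (simp_all add: field_simps)
  have d_rel: "(1 - q * d) * qpoch (q * (q * d)) q n = G * (1 - q * R * d)"
    using qpoch_contiguous[of "q * d" q n] unfolding G_def R_def by (simp add: mult_ac)
  have b_rel: "(1 - b) * qpoch (q * b) q n = F * (1 - R * b)"
    using qpoch_contiguous[of b q n] unfolding F_def R_def .
  have M: "2 * n + 2 = Suc M" "2 * n + 1 = M"
    by (simp_all add: M_def)
  have 1: "D * odd_term q a b c d n
      = C * ((1 - b / (q * R * a)) * (1 - q * R ^ 3 * b) * (1 - q * R\<^sup>2 * x) * (1 - q * R\<^sup>2 * y)
          * (1 - q * R * v) * (1 - q * R * u))"
    unfolding D_def odd_term_def M R(1,4)
    unfolding x_def[symmetric] y_def[symmetric] v_def[symmetric] u_def[symmetric]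
      w_def[symmetric] E_def[symmetric] U_def[symmetric] F_def[symmetric] G_def[symmetric]
    unfolding x_rel y_rel v_rel u_rel C_def K_def
    using den_nz L_nz by (simp add: mult_ac)
  have 2: "N * odd_term q (q\<^sup>2 * a) (q * b) (q * c) (q * d) n
      = C * ((q * R)\<^sup>2 * (1 - b / (q * (q * R) * a)) * (1 - q * R ^ 3 * (q * b)) * (1 - R * b)
           * (1 - q * R * d) * (1 - c) * (1 - q * a\<^sup>2 / (b * c * d)))"
  proof -
    have pow: "(q\<^sup>2 * w) ^ Suc n = (q * R)\<^sup>2 * w ^ Suc n"
      unfolding power_mult_distrib[of "q\<^sup>2"] R(4)[symmetric]
      by (simp only: power_mult [symmetric] mult.commute)
    have b_a: "q * b / (q * R * (q\<^sup>2 * a)) = b / (q * (q * R) * a)"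
      using q_nz by (simp add: power2_eq_square)
    have "N * odd_term q (q\<^sup>2 * a) (q * b) (q * c) (q * d) n
      = (q * R)\<^sup>2 * (w ^ Suc n * U * K / (E * Lx * Ly * Lv * Lu))
        * (1 - b / (q * (q * R) * a)) * (1 - q * R ^ 3 * (q * b))
        * ((1 - b) * qpoch (q * b) q n) * ((1 - q * d) * qpoch (q * (q * d)) q n)
        * ((1 - c) * (1 - q * a\<^sup>2 / (b * c * d)))"
      unfolding N_def odd_term_def M shifted_args R(1,4) b_a
      unfolding x_def[symmetric] y_def[symmetric] v_def[symmetric] u_def[symmetric]
        w_def[symmetric] E_def[symmetric] U_def[symmetric]
        Lx_def[symmetric] Ly_def[symmetric] Lv_def[symmetric] Lu_def[symmetric] C_def K_def pow
      by (simp only: times_divide_eq_right times_divide_eq_left mult_ac)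
    then show ?thesis
      unfolding b_rel d_rel C_def by (simp only: times_divide_eq_right times_divide_eq_left mult_ac)
  qed
  have 3: "odd_cert q a b c d n
      = - (C * (b / (q * R * a) * (1 - q * R\<^sup>2 * a) * (1 - q * R\<^sup>2) * (1 - q * R\<^sup>2 * x)
             * (1 - q * R\<^sup>2 * y) * (1 - q * R * v) * (1 - q * R * u)))"
  proof -
    define Z where "Z = U * F * G * K / (qpoch q q (2 * n) * qpoch (q * x) q (2 * n)
        * qpoch (q * y) q (2 * n) * qpoch (q * v) q n * qpoch (q * u) q n)"
    \<comment> \<open>The certificate carries \<open>w ^ n\<close> but \<open>C\<close> carries
      \<open>w ^ Suc n\<close>; the definition of \<open>w\<close> supplies the missing
      factor.\<close>
    have pow: "a / d * w ^ n = w ^ Suc n * (b / (q * R * a))"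
      using nonzero q_nz R(5) by (simp add: w_def power2_eq_square)
    have "E = qpoch q q (2 * n) * (1 - q * R\<^sup>2)" "Lx = qpoch (q * x) q (2 * n) * (1 - q * R\<^sup>2 * x)"
      "Ly = qpoch (q * y) q (2 * n) * (1 - q * R\<^sup>2 * y)" "Lv = qpoch (q * v) q n * (1 - q * R * v)"
      "Lu = qpoch (q * u) q n * (1 - q * R * u)"
      unfolding E_def Lx_def Ly_def Lv_def Lu_def R(2)[symmetric] R(4)[symmetric]
      unfolding M_def qpoch_Suc by (simp_all add: mult_ac)
    then have C_eq: "C * ((1 - q * R\<^sup>2) * (1 - q * R\<^sup>2 * x) * (1 - q * R\<^sup>2 * y)
          * (1 - q * R * v) * (1 - q * R * u)) = w ^ Suc n * Z"
      unfolding C_def Z_def using L_nz factor_nz by (simp add: divide_simps)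
    have "odd_cert q a b c d n = - (a / d * w ^ n * (1 - q * R\<^sup>2 * a) * Z)"
      unfolding odd_cert_def M R(2,4)
      unfolding x_def[symmetric] y_def[symmetric] v_def[symmetric] u_def[symmetric]
        w_def[symmetric] U_def[symmetric] F_def[symmetric] G_def[symmetric] K_def Z_def
      by simp
    also have "\<dots> = - (b / (q * R * a) * (1 - q * R\<^sup>2 * a) * (w ^ Suc n * Z))"
      unfolding pow by (simp only: mult_ac)
    finally show ?thesis
      unfolding C_eq[symmetric] by (simp only: mult_ac)
  qed
  have 4: "even_cert q a b c d n
      = - (C * ((1 - (q * R)\<^sup>2 * a) * (1 - R * b) * (1 - q * R\<^sup>2 * (b * d / a))
           * (1 - R * (b * c / a)) * (1 - R * (q * a / (c * d))) * (1 - q * R * v)))"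
  proof -
    have "Lv = qpoch (q * v) q n * (1 - q * R * v)"
      unfolding Lv_def R(4)[symmetric] qpoch_Suc by (simp add: mult_ac)
    moreover have "q ^ Suc M = (q * R)\<^sup>2"
      using R(2) by (simp add: power2_eq_square)
    ultimately show ?thesis
      unfolding even_cert_def M K_def C_def
      unfolding qpoch_Suc[of "b * c / a"] qpoch_Suc[of "q * a / (c * d)"] qpoch_Suc[of b]
        qpoch_Suc[of "b * d / a" q M] R(2,3,4)
      unfolding x_def[symmetric] y_def[symmetric] v_def[symmetric] u_def[symmetric]
      unfolding w_def[symmetric] U_def[symmetric] F_def[symmetric] G_def[symmetric] E_def[symmetric]
        Lx_def[symmetric] Ly_def[symmetric] Lu_def[symmetric]
      using L_nz factor_nz by (simp add: divide_simps)
  qed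
  show ?thesis
    unfolding 1 2 3 4
    using odd_polynomial_identity[OF nonzero q_nz R(5)]
    unfolding x_def y_def v_def u_def
    by (simp only: right_diff_distrib [symmetric] diff_minus_eq_add uminus_add_conv_diff)
qed

text \<open>The start of the telescoping: g_1 belongs to the constant term 1 of both series, so it
  must equal \<open>D - N\<close>, which factors explicitly.\<close>

lemma certificate_0: "odd_cert q a b c d 0 = D - N"
  unfolding odd_cert_def D_def N_def using nonzero
  by (simp add: qpoch_Suc divide_simps) algebra

section \<open>Estimates and limits\<close>

text \<open>A catalogue of the factors of terms and certificates. Together with the closure rules
  for products and quotients it proves boundedness by resolution, jointly in \<open>m\<close> and
  \<open>k\<close>.\<close>

lemma bounded_factors:
  fixes m k :: "'i \<Rightarrow> nat"
  shows "bounded (range (\<lambda>i. qpoch x q (k i)))" "bounded (range (\<lambda>i. qpoch (q ^ m i * x) q (k i)))"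
    "bounded (range (\<lambda>i. 1 - q ^ k i * x))" "bounded (range (\<lambda>i. 1 - q ^ k i * (q ^ m i * x)))"
    "bounded (range (\<lambda>i. q ^ k i))" "bounded (range (\<lambda>i. q ^ k i - x))"
    "bounded (range (\<lambda>i. inverse (qpoch q q (k i))))"
    "bounded (range (\<lambda>i. inverse (qpoch (q ^ m i * (q * a / c)) q (k i))))"
    "bounded (range (\<lambda>i. inverse (qpoch (q ^ m i * (b * c * d / a)) q (k i))))"
    "bounded (range (\<lambda>i. inverse (qpoch (q ^ m i * (q * a / b)) q (k i))))"
    "bounded (range (\<lambda>i. inverse (qpoch (q ^ m i * (a / d)) q (k i))))"
proof -
  have le_1: "norm (q ^ j) \<le> 1" for j
    using q_less_1 by (simp add: norm_power power_le_one)
  show "bounded (range (\<lambda>i. qpoch x q (k i)))" "bounded (range (\<lambda>i. qpoch (q ^ m i * x) q (k i)))"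
    using q_less_1 le_1 mult_right_mono[OF le_1 norm_ge_zero[of x]]
    by (auto intro!: qpoch_bounded[where r = "norm x"] simp: norm_mult)
  have "norm (1 - q ^ j * x) \<le> 1 + norm x" for j
    using norm_triangle_ineq4[of 1 "q ^ j * x"] mult_right_mono[OF le_1[of j] norm_ge_zero[of x]]
    by (simp add: norm_mult)
  then show "bounded (range (\<lambda>i. 1 - q ^ k i * x))" "bounded (range (\<lambda>i. 1 - q ^ k i * (q ^ m i * x)))"
    unfolding bounded_iff mult.assoc[symmetric] power_add[symmetric] by blast+
  show pow: "bounded (range (\<lambda>i. q ^ k i))"
    using le_1 unfolding bounded_iff by blast
  show "bounded (range (\<lambda>i. q ^ k i - x))"
    using bounded_minus_comp[OF pow, of "\<lambda>_. x"] by simp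
  show "bounded (range (\<lambda>i. inverse (qpoch q q (k i))))"
    using qpoch_inverse_bounded[OF q_less_1 q_power_nz, where m = "\<lambda>_. 0"] by simp
qed (intro qpoch_inverse_bounded q_less_1 all_nz)+

text \<open>Apart from the power of the base, the certificate is a quotient \<open>g\<close> of
  bounded products, so the superexponential decay of the power decides.\<close>

lemma odd_cert_tendsto_0: "odd_cert q a b c d \<longlonglongrightarrow> 0"
proof -
  \<comment> \<open>Two powers of \<open>q\<close> go into \<open>w\<close> so that the base at
    index \<open>Suc n\<close> is \<open>q ^ n * w\<close>, matching the majorant.\<close>
  define w where "w = q\<^sup>2 * a\<^sup>2 / (b * d)"
  define g where "g n = - (a / d) * (1 - q ^ (2 * n + 1) * a)
     * (qpoch (b * d / a) q (2 * n + 1) * qpoch b q n * qpoch (q * d) q n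
        * (qpoch (q * a / (b * c)) q (Suc n) * qpoch (b * c / a) q n
        * qpoch (q * a / (c * d)) q n * qpoch (c * d / a) q (Suc n)))
     / (qpoch q q (2 * n) * qpoch (q * (q * a / c)) q (2 * n) * qpoch (q * (b * c * d / a)) q (2 * n)
        * qpoch (q * (q * a / b)) q n * qpoch (q * (a / d)) q n)" for n
  have "bounded (range g)"
    unfolding g_def
    by (intro bounded_range_divide bounded_range_mult bounded_range_inverse_mult bounded_factors
        bounded_factors(8-11)[where m = "\<lambda>_. 1", unfolded power_one_right])
      (simp add: bounded_iff, blast)
  then obtain K where K: "\<And>n. norm (g n) \<le> K" by (auto simp: bounded_iff)
  have "odd_cert q a b c d n = (q ^ Suc n * a\<^sup>2 / (b * d)) ^ n * g n" for n
    unfolding odd_cert_def g_def by (simp only: times_divide_eq_right times_divide_eq_left mult_ac)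
  moreover have "q ^ Suc (Suc n) * a\<^sup>2 / (b * d) = q ^ n * w" for n
    unfolding w_def by (simp add: power2_eq_square)
  ultimately have "norm (odd_cert q a b c d (Suc n)) = norm (q ^ n * w) ^ Suc n * norm (g (Suc n))" for n
    by (simp only: norm_mult norm_power)
  then have "norm (odd_cert q a b c d (Suc n)) \<le> norm (q ^ n * w) ^ Suc n * K" for n
    using mult_left_mono[OF K zero_le_power[OF norm_ge_zero]] by metis
  moreover have "(\<lambda>n. norm (q ^ n * w) ^ Suc n * K) \<longlonglongrightarrow> 0"
    using superexponential_summable[OF q_less_1] by (intro tendsto_mult_left_zero summable_LIMSEQ_zero)
  ultimately have "(\<lambda>n. odd_cert q a b c d (Suc n)) \<longlonglongrightarrow> 0"
    by (rule Lim_null_comparison[OF always_eventually[OF allI]])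
  then show ?thesis by (rule LIMSEQ_imp_Suc)
qed

text \<open>Scaling multiplies the power by \<open>q ^ (2 * m * Suc n)\<close>. One
  \<open>q ^ m\<close> is kept as the decay in \<open>m\<close>; another compensates the growing
  quotient \<open>b / (q ^ Suc n * a)\<close> of the odd term, whose scaling contributes an inverse
  \<open>q ^ m\<close>.\<close>

lemma summand_scaled_bound:
  "\<exists>K. \<forall>m n. norm (summand q ((q ^ m)\<^sup>2 * a) (q ^ m * b) (q ^ m * c) (q ^ m * d) n)
      \<le> K * norm q ^ m * norm (q ^ n * (a\<^sup>2 / (b * d))) ^ Suc n"
proof -
  define w where "w = a\<^sup>2 / (b * d)"
  \<comment> \<open>\<open>f\<close> and \<open>g\<close> are the cofactors of the small factor in
    the even and odd terms, indexed by pairs so that one bound covers all \<open>m\<close> and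
    \<open>n\<close>.\<close>
  define f where "f = (\<lambda>(m, n). q ^ (m + 2 * m * n + Suc n) * (1 - q ^ (3 * n + 3) * (q ^ m * d))
     * (qpoch (b * d / a) q (2 * n + 2) * qpoch (q ^ m * b) q (Suc n) * qpoch (q ^ m * (q * d)) q n
        * (qpoch (q * a / (b * c)) q (Suc n) * qpoch (b * c / a) q (Suc n)
        * qpoch (q * a / (c * d)) q (Suc n) * qpoch (c * d / a) q (Suc n)))
     / (qpoch q q (2 * n + 2) * qpoch (q ^ m * (q * a / c)) q (2 * n + 2)
        * qpoch (q ^ m * (b * c * d / a)) q (2 * n + 2)
        * qpoch (q ^ m * (q * a / b)) q (Suc n) * qpoch (q ^ m * (a / d)) q (Suc n)))"
  define g where "g = (\<lambda>(m, n). q ^ (2 * m * n) * (q ^ (m + Suc n) - b / a)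
     * (1 - q ^ (3 * n + 1) * (q ^ m * b))
     * (qpoch (b * d / a) q (2 * n + 1) * qpoch (q ^ m * b) q n * qpoch (q ^ m * (q * d)) q n
        * (qpoch (q * a / (b * c)) q (Suc n) * qpoch (b * c / a) q n
        * qpoch (q * a / (c * d)) q n * qpoch (c * d / a) q (Suc n)))
     / (qpoch q q (2 * n + 1) * qpoch (q ^ m * (q * a / c)) q (2 * n + 1)
        * qpoch (q ^ m * (b * c * d / a)) q (2 * n + 1)
        * qpoch (q ^ m * (q * a / b)) q (Suc n) * qpoch (q ^ m * (a / d)) q (Suc n)))"
  have f: "bounded (range f)" and g: "bounded (range g)"
    unfolding f_def g_def case_prod_unfold
    by (intro bounded_range_divide bounded_range_mult bounded_range_inverse_mult bounded_factors)+
  obtain B where B: "\<And>i. norm (f i) \<le> B" using f by (auto simp: bounded_iff)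
  obtain C where C: "\<And>i. norm (g i) \<le> C" using g by (auto simp: bounded_iff)
  have "norm (summand q ((q ^ m)\<^sup>2 * a) (q ^ m * b) (q ^ m * c) (q ^ m * d) n)
      \<le> (B + C) * norm q ^ m * norm (q ^ n * w) ^ Suc n" for m n
  proof -
    have r: "q ^ m \<noteq> 0" using q_nz by simp
    have pow: "((q ^ m)\<^sup>2 * (q ^ Suc n * a\<^sup>2 / (b * d))) ^ Suc n
        = q ^ m * (q ^ n * w) ^ Suc n * q ^ (m + 2 * m * n + Suc n)"
    proof -
      have "(q ^ m)\<^sup>2 * (q ^ Suc n * a\<^sup>2 / (b * d)) = q ^ (2 * m + 1) * (q ^ n * w)"
        by (simp add: w_def power_add power_mult [symmetric] mult.commute[of m])
      moreover have "(2 * m + 1) * Suc n = m + (m + 2 * m * n + Suc n)"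
        by (simp add: algebra_simps)
      then have "(q ^ (2 * m + 1)) ^ Suc n = q ^ m * q ^ (m + 2 * m * n + Suc n)"
        by (metis power_add power_mult)
      ultimately show ?thesis by (simp only: power_mult_distrib mult_ac)
    qed
    have "even_term q ((q ^ m)\<^sup>2 * a) (q ^ m * b) (q ^ m * c) (q ^ m * d) n
        = q ^ m * (q ^ n * w) ^ Suc n * f (m, n)"
      unfolding even_term_def scaled_args[OF r] pow f_def prod.case mult.left_commute[of q "q ^ m"]
      by (simp only: times_divide_eq_right times_divide_eq_left mult_ac)
    moreover have "odd_term q ((q ^ m)\<^sup>2 * a) (q ^ m * b) (q ^ m * c) (q ^ m * d) n
        = q ^ m * (q ^ n * w) ^ Suc n * g (m, n)"
    proof -
      \<comment> \<open>The reserved powers of \<open>q\<close> clear the denominator, leaving a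
        bounded difference.\<close>
      have "q ^ (m + 2 * m * n + Suc n) * (1 - q ^ m * b / (q ^ Suc n * ((q ^ m)\<^sup>2 * a)))
        = q ^ (2 * m * n) * (q ^ (m + Suc n) - b / a)"
        using r q_nz nonzero by (simp add: power_add power2_eq_square field_simps)
      then have "((q ^ m)\<^sup>2 * (q ^ Suc n * a\<^sup>2 / (b * d))) ^ Suc n
          * (1 - q ^ m * b / (q ^ Suc n * ((q ^ m)\<^sup>2 * a)))
        = q ^ m * (q ^ n * w) ^ Suc n * (q ^ (2 * m * n) * (q ^ (m + Suc n) - b / a))"
        unfolding pow by (simp only: mult.assoc)
      then show ?thesis
        unfolding odd_term_def scaled_args[OF r] g_def prod.case mult.left_commute[of q "q ^ m"]
        by (simp only: times_divide_eq_right times_divide_eq_left mult.assoc)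
    qed
    ultimately have "summand q ((q ^ m)\<^sup>2 * a) (q ^ m * b) (q ^ m * c) (q ^ m * d) n
        = q ^ m * (q ^ n * w) ^ Suc n * (f (m, n) - g (m, n))"
      unfolding summand_def by (simp only: right_diff_distrib)
    then have "norm (summand q ((q ^ m)\<^sup>2 * a) (q ^ m * b) (q ^ m * c) (q ^ m * d) n)
        = norm q ^ m * norm (q ^ n * w) ^ Suc n * norm (f (m, n) - g (m, n))"
      by (simp only: norm_mult norm_power)
    also have "\<dots> \<le> norm q ^ m * norm (q ^ n * w) ^ Suc n * (B + C)"
      using B[of "(m, n)"] C[of "(m, n)"] norm_triangle_ineq4[of "f (m, n)" "g (m, n)"]
      by (intro mult_left_mono) auto
    finally show ?thesis by (simp only: mult_ac)
  qed
  then show ?thesis unfolding w_def by (intro exI[of _ "B + C"] allI)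
qed

lemma summand_summable: "summable (summand q a b c d)"
proof -
  from summand_scaled_bound obtain K where K: "\<forall>m n. norm (summand q ((q ^ m)\<^sup>2 * a) (q ^ m * b) (q ^ m * c) (q ^ m * d) n)
      \<le> K * norm q ^ m * norm (q ^ n * (a\<^sup>2 / (b * d))) ^ Suc n"
    ..
  show ?thesis
  proof (rule summable_comparison_test')
    show "summable (\<lambda>n. K * norm (q ^ n * (a\<^sup>2 / (b * d))) ^ Suc n)"
      using superexponential_summable[OF q_less_1] by (rule summable_mult)
    show "norm (summand q a b c d n) \<le> K * norm (q ^ n * (a\<^sup>2 / (b * d))) ^ Suc n" for n
      using K[rule_format, of 0 n] by simp
  qed
qed

section \<open>The contiguous relation and its iteration\<close>

text \<open>Adding \<open>even_step\<close> and \<open>odd_step\<close> cancels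
  \<open>even_cert\<close>, so only the odd certificates telescope. Their limit is 0 and their start
  is \<open>D - N\<close>, which accounts exactly for the two constant terms 1.\<close>

lemma contiguous_relation:
  "D * (1 + suminf (summand q a b c d))
   = N * (1 + suminf (summand q (q\<^sup>2 * a) (q * b) (q * c) (q * d)))"
proof -
  interpret shifted: admissible q "q\<^sup>2 * a" "q * b" "q * c" "q * d"
    by (rule shifted_admissible)
  define e e' v v' where "e = even_term q a b c d"
    and "e' = even_term q (q\<^sup>2 * a) (q * b) (q * c) (q * d)"
    and "v = odd_term q a b c d" and "v' = odd_term q (q\<^sup>2 * a) (q * b) (q * c) (q * d)"
  have "odd_cert q a b c d (Suc n) - odd_cert q a b c d n
      = D * summand q a b c d n - N * summand q (q\<^sup>2 * a) (q * b) (q * c) (q * d) n" for n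
  proof -
    have "odd_cert q a b c d (Suc n) - odd_cert q a b c d n
        = (D * e n - N * e' n) + (N * v' n - D * v n)"
      unfolding e_def e'_def v_def v'_def even_step odd_step by simp
    also have "\<dots> = D * (e n - v n) - N * (e' n - v' n)"
      by (simp add: right_diff_distrib)
    finally show ?thesis
      unfolding summand_def e_def e'_def v_def v'_def .
  qed
  then have "(\<lambda>n. D * summand q a b c d n - N * summand q (q\<^sup>2 * a) (q * b) (q * c) (q * d) n)
      sums (0 - odd_cert q a b c d 0)"
    using telescope_sums[OF odd_cert_tendsto_0] by simp
  moreover have "(\<lambda>n. D * summand q a b c d n - N * summand q (q\<^sup>2 * a) (q * b) (q * c) (q * d) n)
      sums (D * suminf (summand q a b c d) - N * suminf (summand q (q\<^sup>2 * a) (q * b) (q * c) (q * d)))"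
    by (intro sums_diff sums_mult summable_sums summand_summable shifted.summand_summable)
  ultimately have "D * suminf (summand q a b c d)
      - N * suminf (summand q (q\<^sup>2 * a) (q * b) (q * c) (q * d)) = N - D"
    unfolding certificate_0 by (auto dest: sums_unique2)
  then show ?thesis by (simp add: algebra_simps)
qed

text \<open>The contiguous relation applied \<open>m\<close> times; each application supplies the
  next factor of all eight products.\<close>

lemma qpoch_mult_series:
  "qpoch (q * a / b) q m * qpoch (q * a / c) q m * qpoch (a / d) q m * qpoch (b * c * d / a) q m
     * (1 + suminf (summand q a b c d))
   = qpoch b q m * qpoch c q m * qpoch (q * d) q m * qpoch (q * a\<^sup>2 / (b * c * d)) q m
     * (1 + suminf (summand q ((q ^ m)\<^sup>2 * a) (q ^ m * b) (q ^ m * c) (q ^ m * d)))"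
proof (induction m)
  case 0
  show ?case by simp
next
  case (Suc m)
  interpret scaled: admissible q "(q ^ m)\<^sup>2 * a" "q ^ m * b" "q ^ m * c" "q ^ m * d"
    by (rule scaled_admissible)
  define S where "S m = 1 + suminf (summand q ((q ^ m)\<^sup>2 * a) (q ^ m * b) (q ^ m * c) (q ^ m * d))" for m
  have r: "q ^ m \<noteq> 0" using q_nz by simp
  \<comment> \<open>The argument of the last numerator product also has weight 1; it is not among
    \<open>scaled_args\<close>.\<close>
  have "q * ((q ^ m)\<^sup>2 * a)\<^sup>2 / (q ^ m * b * (q ^ m * c) * (q ^ m * d)) = q ^ m * (q * a\<^sup>2 / (b * c * d))"
    using r by (simp add: power2_eq_square mult_ac)
  then have step: "(1 - q ^ m * (q * a / b)) * (1 - q ^ m * (q * a / c)) * (1 - q ^ m * (a / d))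
        * (1 - q ^ m * (b * c * d / a)) * S m
      = (1 - q ^ m * b) * (1 - q ^ m * c) * (1 - q ^ m * (q * d)) * (1 - q ^ m * (q * a\<^sup>2 / (b * c * d)))
        * S (Suc m)"
    using scaled.contiguous_relation
    unfolding scaled.D_def scaled.N_def scaled_args[OF r] S_def
    by (simp add: power2_eq_square mult_ac)
  have "qpoch (q * a / b) q (Suc m) * qpoch (q * a / c) q (Suc m) * qpoch (a / d) q (Suc m)
      * qpoch (b * c * d / a) q (Suc m) * S 0
    = (1 - q ^ m * (q * a / b)) * (1 - q ^ m * (q * a / c)) * (1 - q ^ m * (a / d))
        * (1 - q ^ m * (b * c * d / a))
      * (qpoch (q * a / b) q m * qpoch (q * a / c) q m * qpoch (a / d) q m * qpoch (b * c * d / a) q m * S 0)"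
    unfolding qpoch_Suc by (simp only: mult_ac)
  also have "\<dots> = (qpoch b q m * qpoch c q m * qpoch (q * d) q m * qpoch (q * a\<^sup>2 / (b * c * d)) q m)
     * ((1 - q ^ m * (q * a / b)) * (1 - q ^ m * (q * a / c)) * (1 - q ^ m * (a / d))
        * (1 - q ^ m * (b * c * d / a)) * S m)"
    using Suc unfolding S_def by (simp add: mult_ac)
  also have "\<dots> = qpoch b q (Suc m) * qpoch c q (Suc m) * qpoch (q * d) q (Suc m)
      * qpoch (q * a\<^sup>2 / (b * c * d)) q (Suc m) * S (Suc m)"
    unfolding step qpoch_Suc by (simp only: mult_ac)
  finally show ?case unfolding S_def by simp
qed

text \<open>Summing the bound over \<open>n\<close> leaves a constant times
  \<open>norm q ^ m\<close>, because the majorant does not depend on \<open>m\<close>.\<close>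

lemma scaled_series_tendsto_0:
  "(\<lambda>m. suminf (summand q ((q ^ m)\<^sup>2 * a) (q ^ m * b) (q ^ m * c) (q ^ m * d))) \<longlonglongrightarrow> 0"
proof -
  from summand_scaled_bound obtain K where K: "\<forall>m n. norm (summand q ((q ^ m)\<^sup>2 * a) (q ^ m * b) (q ^ m * c) (q ^ m * d) n)
      \<le> K * norm q ^ m * norm (q ^ n * (a\<^sup>2 / (b * d))) ^ Suc n"
    ..
  define L where "L = (\<Sum>n. norm (q ^ n * (a\<^sup>2 / (b * d))) ^ Suc n)"
  have "norm (suminf (summand q ((q ^ m)\<^sup>2 * a) (q ^ m * b) (q ^ m * c) (q ^ m * d))) \<le> K * norm q ^ m * L" for m
    unfolding L_def suminf_mult[OF superexponential_summable[OF q_less_1], symmetric]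
    using K[rule_format] by (intro norm_suminf_le summable_mult superexponential_summable q_less_1)
  moreover have "(\<lambda>m. K * norm q ^ m * L) \<longlonglongrightarrow> 0"
    using q_less_1 by (intro tendsto_mult_left_zero tendsto_mult_right_zero LIMSEQ_power_zero) simp
  ultimately show ?thesis
    by (rule Lim_null_comparison[OF always_eventually[OF allI]])
qed

text \<open>By \<open>qpoch_mult_series\<close> two expressions in \<open>m\<close> coincide;
  letting \<open>m\<close> tend to infinity turns finite products into infinite ones and the scaled
  series into 1.\<close>

lemma product_expansion:
  "qpoch_inf (q * a / b) q * qpoch_inf (q * a / c) q * qpoch_inf (a / d) q * qpoch_inf (b * c * d / a) q
     * (1 + suminf (summand q a b c d))
   = qpoch_inf b q * qpoch_inf c q * qpoch_inf (q * d) q * qpoch_inf (q * a\<^sup>2 / (b * c * d)) q"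
proof -
  define S where "S m = suminf (summand q ((q ^ m)\<^sup>2 * a) (q ^ m * b) (q ^ m * c) (q ^ m * d))" for m
  have "(\<lambda>m. qpoch b q m * qpoch c q m * qpoch (q * d) q m * qpoch (q * a\<^sup>2 / (b * c * d)) q m * (1 + S m))
    \<longlonglongrightarrow> qpoch_inf b q * qpoch_inf c q * qpoch_inf (q * d) q * qpoch_inf (q * a\<^sup>2 / (b * c * d)) q * (1 + 0)"
    unfolding S_def by (intro tendsto_intros qpoch_tendsto q_less_1 scaled_series_tendsto_0)
  moreover have "(\<lambda>m. qpoch (q * a / b) q m * qpoch (q * a / c) q m * qpoch (a / d) q m
      * qpoch (b * c * d / a) q m * (1 + suminf (summand q a b c d)))
    \<longlonglongrightarrow> qpoch_inf (q * a / b) q * qpoch_inf (q * a / c) q * qpoch_inf (a / d) q * qpoch_inf (b * c * d / a) q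
     * (1 + suminf (summand q a b c d))"
    by (intro tendsto_intros qpoch_tendsto q_less_1)
  ultimately show ?thesis
    unfolding qpoch_mult_series S_def using LIMSEQ_unique by fastforce
qed

end

section \<open>Comparison with the series as stated\<close>

text \<open>Every denominator of \<open>W\<close> cancels: \<open>1 - d\<close> and
  \<open>e1\<close> to \<open>e4\<close> against numerator products, \<open>e5\<close> against the
  prefactor.\<close>

lemma summand_eq:
  fixes q a b c d :: complex
  assumes nz: "q \<noteq> 0" "1 - d \<noteq> 0" "W_denom q (Suc n) a b c d \<noteq> 0"
    and den: "qpochs [q, q * a / c, b * c * d / a] q (2 * Suc n) * qpochs [q * a / b, a / d] q (Suc n) \<noteq> 0"
  shows "W q (Suc n) a b c d * (q ^ Suc n * a\<^sup>2 / (b * d)) ^ Suc n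
             * (qpoch (b * d / a) q (2 * Suc n)
                * qpochs [b, d, q * a / (b * c), b * c / a, q * a / (c * d), c * d / a] q (Suc n))
             / (qpochs [q, q * a / c, b * c * d / a] q (2 * Suc n) * qpochs [q * a / b, a / d] q (Suc n))
    = summand q a b c d n"
proof -
  \<comment> \<open>\<open>e1\<close> to \<open>e4\<close> are last factors of numerator products,
    and \<open>f1\<close>, \<open>f3\<close>, \<open>f4\<close> last factors of the three long
    denominators. \<open>f2\<close> and \<open>f5\<close> survive in
    \<open>odd_term\<close>.\<close>
  define e1 e2 e3 e4 e5 where "e1 = 1 - q ^ Suc n * a / (c * d)" and "e2 = 1 - q ^ n * b"
    and "e3 = 1 - q ^ n * b * c / a" and "e4 = 1 - q ^ (2 * n + 1) * b * d / a"
    and "e5 = 1 - q ^ (3 * n + 3) * d"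
  define f1 f2 f3 f4 f5 where "f1 = 1 - q ^ (2 * n + 2)" and "f2 = 1 - b / (q ^ Suc n * a)"
    and "f3 = 1 - q ^ (2 * n + 2) * a / c" and "f4 = 1 - q ^ (2 * n + 1) * b * c * d / a"
    and "f5 = 1 - q ^ (3 * n + 1) * b"
  have idx: "2 * Suc n = 2 * n + 2" "2 * Suc n - 1 = 2 * n + 1" "3 * Suc n = 3 * n + 3"
    "3 * Suc n - 2 = 3 * n + 1" "Suc n - 1 = n"
    "2 * n + 2 - 1 = 2 * n + 1" "3 * n + 3 - 2 = 3 * n + 1" by simp_all
  have W_denom: "W_denom q (Suc n) a b c d = e1 * e2 * e3 * e4 * e5"
    unfolding W_denom_def idx e1_def e2_def e3_def e4_def e5_def ..
  then have e_nz: "e1 \<noteq> 0" "e2 \<noteq> 0" "e3 \<noteq> 0" "e4 \<noteq> 0" "e5 \<noteq> 0"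
    using nz by auto
  have "q powi (- int (Suc n)) * b / a = b / (q ^ Suc n * a)"
    by (simp only: power_int_minus power_int_of_nat) (simp add: field_simps)
  then have W: "W q (Suc n) a b c d = e5 / (1 - d) * (1 - f1 * f2 * f3 * f4 * f5 / (e1 * e2 * e3 * e4 * e5))"
    unfolding W_def W_denom idx e5_def f1_def f2_def f3_def f4_def f5_def by simp
  have "qpoch (b * d / a) q (2 * n + 2) = qpoch (b * d / a) q (2 * n + 1) * e4"
    "qpoch b q (Suc n) = qpoch b q n * e2"
    "qpoch d q (Suc n) = (1 - d) * qpoch (q * d) q n"
    "qpoch (b * c / a) q (Suc n) = qpoch (b * c / a) q n * e3"
    "qpoch (q * a / (c * d)) q (Suc n) = qpoch (q * a / (c * d)) q n * e1"
    "qpoch q q (2 * n + 2) = qpoch q q (2 * n + 1) * f1"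
    "qpoch (q * a / c) q (2 * n + 2) = qpoch (q * a / c) q (2 * n + 1) * f3"
    "qpoch (b * c * d / a) q (2 * n + 2) = qpoch (b * c * d / a) q (2 * n + 1) * f4"
    using qpoch_Suc_shift[of d q n]
    by (simp_all add: qpoch_Suc e1_def e2_def e3_def e4_def f1_def f3_def f4_def mult_ac)
  note eqs = this
  have den_eq: "qpochs [q, q * a / c, b * c * d / a] q (2 * n + 2) * qpochs [q * a / b, a / d] q (Suc n)
      = qpoch q q (2 * n + 1) * qpoch (q * a / c) q (2 * n + 1) * qpoch (b * c * d / a) q (2 * n + 1)
        * qpoch (q * a / b) q (Suc n) * qpoch (a / d) q (Suc n) * (f1 * f3 * f4)"
    unfolding qpochs_def list.map prod_list.Cons prod_list.Nil eqs by (simp only: mult_ac mult_1_left mult_1_right)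
  have den': "f1 \<noteq> 0" "f3 \<noteq> 0" "f4 \<noteq> 0" "qpoch q q (2 * n + 1) \<noteq> 0"
     "qpoch (q * a / c) q (2 * n + 1) \<noteq> 0" "qpoch (b * c * d / a) q (2 * n + 1) \<noteq> 0"
     "qpoch (q * a / b) q (Suc n) \<noteq> 0" "qpoch (a / d) q (Suc n) \<noteq> 0"
    using den unfolding idx den_eq by auto
  have 1: "qpoch (b * d / a) q (2 * n + 2)
        * qpochs [b, d, q * a / (b * c), b * c / a, q * a / (c * d), c * d / a] q (Suc n)
      = (1 - d) * (e1 * e2 * e3 * e4) * (qpoch (b * d / a) q (2 * n + 1) * qpoch b q n * qpoch (q * d) q n
        * (qpoch (q * a / (b * c)) q (Suc n) * qpoch (b * c / a) q n
        * qpoch (q * a / (c * d)) q n * qpoch (c * d / a) q (Suc n)))"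
    unfolding qpochs_def list.map prod_list.Cons prod_list.Nil eqs
    by (simp only: mult_ac mult_1_left mult_1_right)
  \<comment> \<open>The cancellation in abstract form: \<open>z\<close> is the power,
    \<open>A\<close> the numerator and \<open>B\<close> the denominator of the odd term.\<close>
  have distr: "e5 / (1 - d) * (1 - f1 * f2 * f3 * f4 * f5 / (e1 * e2 * e3 * e4 * e5)) * z
      * ((1 - d) * (e1 * e2 * e3 * e4) * A) / (B * (f1 * f3 * f4))
      = z * e5 * (e1 * e2 * e3 * e4 * A) / (B * (f1 * f3 * f4)) - z * f2 * f5 * A / B"
    for z A B
  proof -
    have "x / p * (1 - r / (e * x)) * z * (p * e * A) = (x * e - r) * z * A"
      if "p \<noteq> 0" "e \<noteq> 0" "x \<noteq> 0" for x p r e :: complex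
      using that by (simp add: field_simps)
    from this[of "1 - d" "e1 * e2 * e3 * e4" e5]
    have num: "e5 / (1 - d) * (1 - f1 * f2 * f3 * f4 * f5 / (e1 * e2 * e3 * e4 * e5)) * z
        * ((1 - d) * (e1 * e2 * e3 * e4) * A)
      = (e5 * (e1 * e2 * e3 * e4) - f1 * f2 * f3 * f4 * f5) * z * A"
      using nz(2) e_nz by simp
    have odd: "z * f2 * f5 * A / B = z * f2 * f5 * A * (f1 * f3 * f4) / (B * (f1 * f3 * f4))"
      using den'(1-3) by simp
    show ?thesis
      unfolding num odd diff_divide_distrib [symmetric]
      by (rule arg_cong[where f = "\<lambda>x. x / (B * (f1 * f3 * f4))"]) (simp add: algebra_simps)
  qed
  have even_eq: "even_term q a b c d n = (q ^ Suc n * a\<^sup>2 / (b * d)) ^ Suc n * e5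
      * (e1 * e2 * e3 * e4 * (qpoch (b * d / a) q (2 * n + 1) * qpoch b q n * qpoch (q * d) q n
        * (qpoch (q * a / (b * c)) q (Suc n) * qpoch (b * c / a) q n
        * qpoch (q * a / (c * d)) q n * qpoch (c * d / a) q (Suc n))))
      / (qpoch q q (2 * n + 1) * qpoch (q * a / c) q (2 * n + 1) * qpoch (b * c * d / a) q (2 * n + 1)
        * qpoch (q * a / b) q (Suc n) * qpoch (a / d) q (Suc n) * (f1 * f3 * f4))"
    unfolding even_term_def eqs e5_def by (simp only: mult_ac)
  show ?thesis
    unfolding idx 1 W den_eq summand_def even_eq odd_term_def f2_def[symmetric] f5_def[symmetric]
    by (rule distr)
qed
theorem theorem6:
  fixes q a b c d :: complex
  assumes q: "0 < norm q" "norm q < 1"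
    and nonzero: "a \<noteq> 0" "b \<noteq> 0" "c \<noteq> 0" "d \<noteq> 0"
    and lhs_denom: "qpoch_inf (q * a / b) q * qpoch_inf (q * a / c) q
                    * qpoch_inf (a / d) q * qpoch_inf (b * c * d / a) q \<noteq> 0"
    and rhs_denom: "\<And>n. n \<ge> 1 \<Longrightarrow>
          qpochs [q, q * a / c, b * c * d / a] q (2 * n) * qpochs [q * a / b, a / d] q n \<noteq> 0"
    and W_denom: "1 - d \<noteq> 0" "\<And>n. n \<ge> 1 \<Longrightarrow> W_denom q n a b c d \<noteq> 0"
  defines "t \<equiv> \<lambda>n. W q n a b c d * (q ^ n * a\<^sup>2 / (b * d)) ^ n
             * (qpoch (b * d / a) q (2 * n)
                * qpochs [b, d, q * a / (b * c), b * c / a, q * a / (c * d), c * d / a] q n)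
             / (qpochs [q, q * a / c, b * c * d / a] q (2 * n) * qpochs [q * a / b, a / d] q n)"
  shows "summable (\<lambda>n. t (Suc n)) \<and>
         qpoch_inf b q * qpoch_inf c q * qpoch_inf (q * d) q * qpoch_inf (q * a\<^sup>2 / (b * c * d)) q
         / (qpoch_inf (q * a / b) q * qpoch_inf (q * a / c) q
            * qpoch_inf (a / d) q * qpoch_inf (b * c * d / a) q)
         = 1 + (\<Sum>n. t (Suc n))"
proof -
  have nz: "qpoch (q * a / c) q (2 * Suc j) \<noteq> 0" "qpoch (b * c * d / a) q (2 * Suc j) \<noteq> 0"
    "qpoch (q * a / b) q (Suc j) \<noteq> 0" "qpoch (a / d) q (Suc j) \<noteq> 0" for j
    using rhs_denom[of "Suc j"] by (simp_all add: qpochs_def)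
  \<comment> \<open>Factor \<open>j\<close> already occurs in a product of length
    \<open>Suc j\<close>, so the denominators of the series yield every condition of the
    locale.\<close>
  have factor_nz: "1 - q ^ j * (q * a / c) \<noteq> 0" "1 - q ^ j * (b * c * d / a) \<noteq> 0"
    "1 - q ^ j * (q * a / b) \<noteq> 0" "1 - q ^ j * (a / d) \<noteq> 0" for j
    by (rule qpoch_nonzero_factor, rule nz[of j], simp)+
  interpret admissible q a b c d
    by unfold_locales (fact q nonzero factor_nz)+
  have t_eq: "(\<lambda>n. t (Suc n)) = summand q a b c d"
    unfolding t_def by (intro ext summand_eq q_nz W_denom rhs_denom) simp_all
  have "(x::complex) / y = z" if "y * z = x" "y \<noteq> 0" for x y z
    using that by auto
  from this[OF product_expansion lhs_denom] show ?thesis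
    unfolding t_eq using summand_summable by blast
qed

end
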